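(* Let $\rho^2,\sigma^2\ge0$ be the signal strength and noise variance, $\mathrm{SNR}=\rho^2/\sigma^2$, and let $\phi\in(0,\infty)$. Consider the functions $\phi_s\mapsto\mathscr R^{\mathrm{sub}}_{0,\infty}(\phi,\phi_s)$ and $\phi_s\mapsto\mathscr R^{\mathrm{spl}}_{0,\phi_s/\phi}(\phi,\phi_s)$ on $[\phi,\infty]$ (limiting risks of ridgeless subagging with $M=\infty$ and of ridgeless splagging with $M=\phi_s/\phi$). (1) $\mathrm{SNR}=0$ ($\rho^2=0$, $\sigma^2\ne0$): the global minimum of both functions equals $\sigma^2$ and is attained at $\phi_s=\infty$. (2) $0<\mathrm{SNR}<\infty$: the global minimum of $\phi_s\mapsto\mathscr R^{\mathrm{sub}}_{0,\infty}(\phi,\phi_s)$ is attained at a point $\phi_s^{\mathrm{sub}}(\phi)\in(1,\infty)$. For $\phi\ge1$ the global minimum of $\phi_s\mapsto\mathscr R^{\mathrm{spl}}_{0,\phi_s/\phi}(\phi,\phi_s)$ is attained at a point $\phi_s^{\mathrm{spl}}(\phi)\in(1,\infty)$; for $\phi\in(0,1)$ it is attained at a point $\phi_s^{\mathrm{spl}}(\phi)\in\{\phi\}\cup(1,\infty)$. (3) $\mathrm{SNR}=\infty$ ($\rho^2\neq0$, $\sigma^2=0$): if $\phi\in(0,1]$, the global minimum of both functions equals $0$ and is attained at any $\phi_s\in[\phi,1]$. If $\phi\in(1,\infty)$, the global minima of both functions are attained at points $\phi_s^{\mathrm{sub}}(\phi),\phi_s^{\mathrm{spl}}(\phi)\i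n[\phi,\infty)$.
   Context: Let $0<r_{\min}\le r_{\max}<\infty$ and let $H,G$ be probability measures supported on $[r_{\min},r_{\max}]$ (limiting spectral distribution of the feature covariance and limiting signal-weighted spectral distribution). For $\theta\in(1,\infty)$, $v(0;\theta)$ is the unique positive solution of $\frac1{v}=\theta\int\frac{r}{1+vr}dH(r)$. With $v=v(0;\theta)$ and $\vartheta\le\theta$, $$\widetilde v(0;\vartheta,\theta)=\frac{\vartheta\int r^2(1+vr)^{-2}dH(r)}{v^{-2}-\vartheta\int r^2(1+vr)^{-2}dH(r)},\qquad \widetilde c(0;\theta)=\int\frac{r}{(1+vr)^2}dG(r);$$ at $\theta=\infty$: $\widetilde v=0$, $\widetilde c=\int r\,dG(r)$ (limits). For $\theta\in(1,\infty]$, $\vartheta\le\theta$: $B_0(\vartheta,\theta)=\rho^2(1+\widetilde v(0;\vartheta,\theta))\widetilde c(0;\theta)$, $V_0(\vartheta,\theta)=\sigma^2\widetilde v(0;\vartheta,\theta)$, $C_0(\theta)=\rho^2\widetilde c(0;\theta)$. For $\theta\in(0,1]$: $B_0(\vartheta,\theta)=C_0(\theta)=0$; $V_0(\vartheta,\theta)=\sigma^2\vartheta/(1-\vartheta)$ for $\theta<1$, and $V_0(\vartheta,1)=\infty$ if $\sigma^2>0$, $=0$ if $\sigma^2=0$. $\mathscr R^{\mathrm{sub}}_{0,\infty}(\phi,\phi_s)=\sigma^2+B_0(\phi,\phi_s)+V_0(\phi,\phi_s)$. $\mathscr R^{\mathrm{spl}}_{0,\phi_s/\phi}(\phi,\phi_s)=\sigma^2+\frac{\phi}{\phi_s}\big(B_0(\phi_s,\phi_s)+V_0(\phi_s,\phi_s)\big)+\big(1-\frac{\phi}{\phi_s}\big)C_0(\phi_s)$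 for $\phi_s\in[\phi,\infty]$, with $\phi/\infty=0$ (the formula is used with the possibly non-integer value $M=\phi_s/\phi$). *)

theory Defs
  imports "HOL-Probability.Probability"
begin

text \<open>
  Aspect ratios range over \<^typ>\<open>ereal\<close>, since the value \<open>\<infinity>\<close> is allowed, and so do the risks, since
  the variance is infinite at \<open>\<theta> = 1\<close>.  The measures \<open>H\<close> and \<open>G\<close> are the limiting spectral
  distribution of the feature covariance and the limiting signal-weighted spectral distribution;
  \<open>rho2\<close> and \<open>sigma2\<close> stand for \<open>\<rho>\<^sup>2\<close> (signal strength) and \<open>\<sigma>\<^sup>2\<close> (noise variance).
\<close>

text \<open>In \<^typ>\<open>ereal\<close> we have \<open>x / 0 = \<infinity>\<close> for \<open>x > 0\<close>, as intended, but \<open>0 / 0 = 0\<close>.\<close>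

definition SNR :: "real \<Rightarrow> real \<Rightarrow> ereal" where
  "SNR rho2 sigma2 = ereal rho2 / ereal sigma2"

text \<open>\<open>v(0;\<theta>)\<close>, meaningful only for \<open>1 < \<theta> < \<infinity>\<close>.\<close>

definition v0 :: "real measure \<Rightarrow> real \<Rightarrow> real" where
  "v0 H \<theta> = (THE v. v > 0 \<and> 1 / v = \<theta> * (\<integral>r. r / (1 + v * r) \<partial>H))"

text \<open>\<open>v~(0;\<tau>,\<theta>)\<close>, for \<open>1 < \<theta>\<close> and \<open>\<tau> \<le> \<theta>\<close>; hence \<open>\<tau>\<close> is finite in the second branch.\<close>

definition tilde_v0 :: "real measure \<Rightarrow> ereal \<Rightarrow> ereal \<Rightarrow> real" where
  "tilde_v0 H \<tau> \<theta> =
     (if \<theta> = \<infinity> then 0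
      else let v = v0 H (real_of_ereal \<theta>);
               I = real_of_ereal \<tau> * (\<integral>r. r\<^sup>2 / (1 + v * r)\<^sup>2 \<partial>H)
           in I / (1 / v\<^sup>2 - I))"

text \<open>\<open>c~(0;\<theta>)\<close>, for \<open>1 < \<theta>\<close>; it depends on \<open>H\<close> through \<open>v(0;\<theta>)\<close>.\<close>

definition tilde_c0 :: "real measure \<Rightarrow> real measure \<Rightarrow> ereal \<Rightarrow> real" where
  "tilde_c0 H G \<theta> =
     (if \<theta> = \<infinity> then (\<integral>r. r \<partial>G)
      else let v = v0 H (real_of_ereal \<theta>) in (\<integral>r. r / (1 + v * r)\<^sup>2 \<partial>G))"

definition B0 :: "real measure \<Rightarrow> real measure \<Rightarrow> real \<Rightarrow> ereal \<Rightarrow> ereal \<Rightarrow> ereal" where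
  "B0 H G rho2 \<tau> \<theta> =
     (if \<theta> \<le> 1 then 0 else ereal (rho2 * (1 + tilde_v0 H \<tau> \<theta>) * tilde_c0 H G \<theta>))"

definition V0 :: "real measure \<Rightarrow> real \<Rightarrow> ereal \<Rightarrow> ereal \<Rightarrow> ereal" where
  "V0 H sigma2 \<tau> \<theta> =
     (if \<theta> < 1 then ereal (sigma2 * real_of_ereal \<tau> / (1 - real_of_ereal \<tau>))
      else if \<theta> = 1 then (if sigma2 > 0 then \<infinity> else 0)
      else ereal (sigma2 * tilde_v0 H \<tau> \<theta>))"

definition C0 :: "real measure \<Rightarrow> real measure \<Rightarrow> real \<Rightarrow> ereal \<Rightarrow> ereal" where
  "C0 H G rho2 \<theta> = (if \<theta> \<le> 1 then 0 else ereal (rho2 * tilde_c0 H G \<theta>))"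

text \<open>Limiting risk of ridgeless subagging with \<open>M = \<infinity>\<close>.\<close>

definition risk_sub ::
  "real measure \<Rightarrow> real measure \<Rightarrow> real \<Rightarrow> real \<Rightarrow> real \<Rightarrow> ereal \<Rightarrow> ereal" where
  "risk_sub H G rho2 sigma2 \<phi> \<phi>s =
     ereal sigma2 + B0 H G rho2 (ereal \<phi>) \<phi>s + V0 H sigma2 (ereal \<phi>) \<phi>s"

text \<open>
  Limiting risk of ridgeless splagging with \<open>M = \<phi>s / \<phi>\<close>.  Division in \<^typ>\<open>ereal\<close> gives
  \<open>\<phi> / \<infinity> = 0\<close>.
\<close>

definition risk_spl ::
  "real measure \<Rightarrow> real measure \<Rightarrow> real \<Rightarrow> real \<Rightarrow> real \<Rightarrow> ereal \<Rightarrow> ereal" where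
  "risk_spl H G rho2 sigma2 \<phi> \<phi>s =
     ereal sigma2 + (ereal \<phi> / \<phi>s) * (B0 H G rho2 \<phi>s \<phi>s + V0 H sigma2 \<phi>s \<phi>s)
       + (1 - ereal \<phi> / \<phi>s) * C0 H G rho2 \<phi>s"

text \<open>\<open>\<phi>s\<close> is a global minimiser of \<open>f\<close> on \<open>[\<phi>, \<infinity>]\<close>.\<close>

abbreviation global_min_at :: "(ereal \<Rightarrow> ereal) \<Rightarrow> real \<Rightarrow> ereal \<Rightarrow> bool" where
  "global_min_at f \<phi> \<phi>s \<equiv> is_arg_min f (\<lambda>x. x \<in> {ereal \<phi>..\<infinity>}) \<phi>s"

end

theory Submission
  imports Defs "HOL-Real_Asymp.Real_Asymp"
begin

text \<open>
  The overparametrised aspect ratios \<open>\<theta> \<in> (1, \<infinity>)\<close> are best described by the solution \<open>v \<in> (0, \<infinity>)\<close> of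
  the fixed-point equation: multiplying it by \<open>v\<close> gives \<open>1 / \<theta> = df1 v\<close>, the integral of
  \<open>vr / (1 + vr)\<close> under \<open>H\<close>, and \<open>df1\<close> increases strictly from \<open>0\<close> to \<open>1\<close>.  Let \<open>df2\<close> be the integral
  of the squared integrand, \<open>c\<close> the integral of \<open>r / (1 + vr)\<^sup>2\<close> under \<open>G\<close>, and
  \<open>L = \<sigma>\<^sup>2 + \<rho>\<^sup>2 c\<close>.  In the variable \<open>v\<close> bias and variance combine, and both risks factor:
  the subagging risk is \<open>L / (1 - \<phi> df2)\<close> and the splagging risk is
  \<open>L (1 + \<phi> df1 df2 / (df1 - df2))\<close>.  In both cases the second factor is at least \<open>1\<close>.

  The point \<open>\<theta> = \<infinity>\<close> is the limit \<open>v \<rightarrow> 0\<close>.  There \<open>L\<close> decreases at a linear rate in \<open>v\<close> when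
  \<open>\<rho>\<^sup>2 > 0\<close>, because \<open>r \<ge> r\<^sub>m\<^sub>i\<^sub>n > 0\<close> on the support, while the second factor exceeds \<open>1\<close> by at most a
  multiple of \<open>v\<^sup>2\<close>.  So some finite \<open>\<theta>\<close> has a strictly smaller risk than the null predictor
  (\<open>interior_beats_null\<close>).  If \<open>\<phi> > 1\<close>, the remaining values of \<open>v\<close> form an interval \<open>(0, V]\<close>, and
  continuity yields a minimiser.

  If \<open>\<phi> \<le> 1\<close> and \<open>\<sigma>\<^sup>2 > 0\<close>, all \<open>v \<in> (0, \<infinity>)\<close> occur and the end \<open>v \<rightarrow> \<infinity>\<close>, that is \<open>\<theta> \<rightarrow> 1\<close>, has to be
  excluded.  The splagging risk tends to \<open>\<infinity>\<close> there because \<open>df1 - df2 \<rightarrow> 0\<close>, and so does the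
  subagging risk if \<open>\<phi> = 1\<close>.  If \<open>\<phi> < 1\<close>, the subagging risk tends to \<open>\<sigma>\<^sup>2 / (1 - \<phi>)\<close>, which is also its
  constant value for \<open>\<theta> < 1\<close>; but it approaches this limit from below, since \<open>1 - df2\<close> is of order
  \<open>1 / v\<close> whereas \<open>c\<close> is only of order \<open>1 / v\<^sup>2\<close> (\<open>sub_beats_underparam\<close>).  Hence the minimiser lies in
  \<open>(1, \<infinity>)\<close>.  For splagging with \<open>\<phi> < 1\<close> the risk on \<open>[\<phi>, 1)\<close> increases in \<open>\<theta>\<close>, which leaves \<open>\<phi>\<close> as the only
  competitor of the interior minimiser.

  All risks are at least \<open>\<sigma>\<^sup>2\<close> (\<open>risk_ge_noise\<close>).  Without signal this bound is attained at \<open>\<theta> = \<infinity>\<close>;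
  without noise it is \<open>0\<close> and is attained at every \<open>\<theta> \<le> 1\<close>, where least squares recovers the signal exactly.
\<close>

section \<open>Minima on half-open and open intervals\<close>

lemma attains_min_Ioc:
  fixes f :: "real \<Rightarrow> real"
  assumes cont: "continuous_on {0<..V} f"
    and u: "0 < u" "u \<le> V" and end0: "eventually (\<lambda>v. f u \<le> f v) (at_right 0)"
  shows "\<exists>v\<in>{0<..V}. \<forall>w\<in>{0<..V}. f v \<le> f w"
proof -
  obtain e where e: "e > 0" "\<And>v. 0 < v \<Longrightarrow> v < e \<Longrightarrow> f u \<le> f v"
    using end0 unfolding eventually_at_right_field by auto
  \<comment> \<open>Points below \<open>e\<close> do no better than \<open>u\<close>, so the compact rest, with \<open>u\<close> included, suffices.\<close>
  let ?K = "{min e u..V}"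
  have "?K \<subseteq> {0<..V}" using e(1) u by auto
  then have "continuous_on ?K f" using cont continuous_on_subset by blast
  moreover have "compact ?K" "?K \<noteq> {}" using u by auto
  ultimately obtain v where v: "v \<in> ?K" "\<And>w. w \<in> ?K \<Longrightarrow> f v \<le> f w"
    using continuous_attains_inf by metis
  have "f v \<le> f w" if "w \<in> {0<..V}" for w
  proof (cases "w \<in> ?K")
    case False
    then have "f u \<le> f w" using that e(2) by auto
    moreover have "f v \<le> f u" using v(2) u by auto
    ultimately show ?thesis by simp
  qed (use v in auto)
  then show ?thesis using v(1) \<open>?K \<subseteq> {0<..V}\<close> by blast
qed

lemma attains_min_Ioi:
  fixes f :: "real \<Rightarrow> real"
  assumes cont: "continuous_on {0<..} f"
    and u: "0 < u" and end0: "eventually (\<lambda>v. f u \<le> f v) (at_right 0)"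
    and t: "0 < t" and endinf: "eventually (\<lambda>v. f t \<le> f v) at_top"
  shows "\<exists>v\<in>{0<..}. \<forall>w\<in>{0<..}. f v \<le> f w"
proof -
  obtain T where T: "\<And>v. v \<ge> T \<Longrightarrow> f t \<le> f v"
    using endinf unfolding eventually_at_top_linorder by auto
  let ?V = "max T (max u t)"
  have "continuous_on {0<..?V} f" by (rule continuous_on_subset[OF cont]) auto
  then obtain v where v: "v \<in> {0<..?V}" "\<And>w. w \<in> {0<..?V} \<Longrightarrow> f v \<le> f w"
    using attains_min_Ioc[OF _ u _ end0, of ?V] by (auto simp: max.coboundedI1 max.coboundedI2)
  have "f v \<le> f w" if "w \<in> {0<..}" for w
  proof (cases "w \<le> ?V")
    case False
    then have "f t \<le> f w" using T by auto
    moreover have "f v \<le> f t" using v(2) t by auto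
    ultimately show ?thesis by simp
  qed (use v that in auto)
  then show ?thesis using v(1) by auto
qed

lemma eventually_small: "0 < x \<Longrightarrow> eventually (\<lambda>v. 0 < v \<and> v < x) (at_right (0::real))"
  using order_tendstoD(2)[OF tendsto_ident_at, of 0 x] eventually_at_right_less[of "0::real"]
  by (auto intro: eventually_conj)

section \<open>Degrees of freedom of a spectral law\<close>

text \<open>
  These are the first and second degrees of freedom of ridge regression per feature, at the ridge
  level \<open>1 / v\<close>.
\<close>
definition df1 :: "real measure \<Rightarrow> real \<Rightarrow> real" where
  "df1 M v = (\<integral>r. v * r / (1 + v * r) \<partial>M)"

definition df2 :: "real measure \<Rightarrow> real \<Rightarrow> real" where
  "df2 M v = (\<integral>r. (v * r / (1 + v * r))\<^sup>2 \<partial>M)"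

text \<open>
  The signal left over after shrinkage at ridge level \<open>1 / v\<close>; at \<open>v = v(0;\<theta>)\<close> this is \<open>c~(0;\<theta>)\<close>.
\<close>
definition unexplained_signal :: "real measure \<Rightarrow> real \<Rightarrow> real" where
  "unexplained_signal M v = (\<integral>r. r / (1 + v * r)\<^sup>2 \<partial>M)"

locale spectral_law = real_distribution M for M +
  fixes a b :: real
  assumes a_pos: "0 < a" and a_le_b: "a \<le> b" and support: "AE r in M. r \<in> {a..b}"
begin

lemma b_pos: "0 < b"
  using a_pos a_le_b by simp

lemma integrable_if_bounded:
  fixes f :: "real \<Rightarrow> real"
  assumes "f \<in> borel_measurable borel" and "\<And>r. r \<in> {a..b} \<Longrightarrow> \<bar>f r\<bar> \<le> B"
  shows "integrable M f"
proof (rule integrable_const_bound[of _ B])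
  show "AE r in M. norm (f r) \<le> B"
    using support by eventually_elim (use assms in auto)
qed (use assms in auto)

text \<open>
  With \<open>f = 0\<close> or with a constant \<open>g\<close> this turns pointwise bounds on \<open>[a, b]\<close> into bounds on integrals;
  the constant \<open>k\<close> keeps strict inequalities strict under integration.
\<close>
lemma expectation_add_le:
  fixes f g :: "real \<Rightarrow> real"
  assumes "integrable M f" "integrable M g" "\<And>r. r \<in> {a..b} \<Longrightarrow> f r + k \<le> g r"
  shows "expectation f + k \<le> expectation g"
proof -
  have "expectation (\<lambda>r. f r + k) \<le> expectation g"
  proof (rule integral_mono_AE)
    show "AE r in M. f r + k \<le> g r"
      using support by eventually_elim (use assms in auto)
  qed (use assms in auto)
  then show ?thesis using assms(1) prob_space by simp
qed

lemma expectation_le: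
  fixes g :: "real \<Rightarrow> real"
  assumes "integrable M g" "\<And>r. r \<in> {a..b} \<Longrightarrow> g r \<le> k"
  shows "expectation g \<le> k"
  using expectation_add_le[of g "\<lambda>_. k" 0] assms prob_space by simp

lemma expectation_ge:
  fixes g :: "real \<Rightarrow> real"
  assumes "integrable M g" "\<And>r. r \<in> {a..b} \<Longrightarrow> k \<le> g r"
  shows "k \<le> expectation g"
  using expectation_add_le[of "\<lambda>_. 0" g k] assms by simp

text \<open>
  Dominated convergence along sequences in \<open>S\<close>; the integrands need to be bounded and continuous only
  for \<open>r\<close> in the support, as they have poles elsewhere.
\<close>
lemma continuous_on_expectation:
  fixes f :: "real \<Rightarrow> real \<Rightarrow> real"
  assumes [measurable]: "\<And>v. f v \<in> borel_measurable borel"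
    and bound: "\<And>v r. v \<in> S \<Longrightarrow> r \<in> {a..b} \<Longrightarrow> \<bar>f v r\<bar> \<le> B"
    and cont: "\<And>r. r \<in> {a..b} \<Longrightarrow> continuous_on S (\<lambda>v. f v r)"
  shows "continuous_on S (\<lambda>v. expectation (f v))"
proof (rule continuous_on_sequentiallyI)
  fix u v assume u: "\<forall>n. u n \<in> S" "v \<in> S" "u \<longlonglongrightarrow> v"
  show "(\<lambda>n. expectation (f (u n))) \<longlonglongrightarrow> expectation (f v)"
  proof (rule integral_dominated_convergence[where w = "\<lambda>_. B"])
    show "AE r in M. (\<lambda>n. f (u n) r) \<longlonglongrightarrow> f v r"
      using support
    proof eventually_elim
      case (elim r)
      show ?case
        by (rule continuous_on_tendsto_compose[OF cont]) (use elim u in auto)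
    qed
    show "AE r in M. norm (f (u n) r) \<le> B" for n
      using support by eventually_elim (use bound u in auto)
  qed auto
qed

lemma integrand_bounds:
  assumes "0 \<le> v" "r \<in> {a..b}"
  shows "0 < r" "0 < 1 + v * r" "1 \<le> 1 + v * r" "0 \<le> v * r / (1 + v * r)" "v * r / (1 + v * r) < 1"
    "v * a / (1 + v * a) \<le> v * r / (1 + v * r)"
    "v * r / (1 + v * r) \<le> v * b / (1 + v * b)" "1 + v * r \<le> 1 + v * b"
proof -
  show r: "0 < r" using assms a_pos by auto
  have p: "0 < 1 + v * x" if "x > 0" for x using assms(1) that by (simp add: add_pos_nonneg)
  show "0 < 1 + v * r" "1 \<le> 1 + v * r" using p r assms by auto
  show "0 \<le> v * r / (1 + v * r)" "v * r / (1 + v * r) < 1"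
    using p r assms by auto
  have mono: "v * x / (1 + v * x) \<le> v * y / (1 + v * y)" if "0 < x" "x \<le> y" for x y
    using p[of x] p[of y] that assms(1) by (simp add: divide_simps algebra_simps mult_left_mono)
  show "v * a / (1 + v * a) \<le> v * r / (1 + v * r)" "v * r / (1 + v * r) \<le> v * b / (1 + v * b)"
    using mono a_pos r assms(2) by auto
  show "1 + v * r \<le> 1 + v * b" using assms by (simp add: mult_left_mono)
qed

lemma integrable_df1 [simp]: "0 \<le> v \<Longrightarrow> integrable M (\<lambda>r. v * r / (1 + v * r))"
  by (rule integrable_if_bounded[of _ 1])
    (measurable, use integrand_bounds in \<open>fastforce simp: abs_le_iff\<close>)

lemma integrable_df2 [simp]: "0 \<le> v \<Longrightarrow> integrable M (\<lambda>r. (v * r / (1 + v * r))\<^sup>2)"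
  by (rule integrable_if_bounded[of _ 1])
    (measurable, use integrand_bounds in \<open>simp add: power_le_one less_imp_le\<close>)

lemma unexplained_signal_integrand_bounds:
  assumes "0 \<le> v" "r \<in> {a..b}"
  shows "0 \<le> r / (1 + v * r)\<^sup>2" "r / (1 + v * r)\<^sup>2 \<le> r"
proof -
  note rb = integrand_bounds[OF assms]
  show "0 \<le> r / (1 + v * r)\<^sup>2" using rb by simp
  have "1 \<le> (1 + v * r)\<^sup>2" using rb(3) by (rule one_le_power)
  then show "r / (1 + v * r)\<^sup>2 \<le> r" using rb(1) by (simp add: divide_le_eq mult_le_cancel_left1)
qed

lemma integrable_unexplained_signal [simp]: "0 \<le> v \<Longrightarrow> integrable M (\<lambda>r. r / (1 + v * r)\<^sup>2)"
  by (rule integrable_if_bounded[of _ b])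
    (measurable, use unexplained_signal_integrand_bounds in \<open>fastforce simp: abs_le_iff\<close>)

lemma continuous_on_df1: "continuous_on {0..} (df1 M)"
  unfolding df1_def
proof (rule continuous_on_expectation[of _ _ 1])
  fix v r assume *: "v \<in> {0::real..}" "r \<in> {a..b}"
  show "\<bar>v * r / (1 + v * r)\<bar> \<le> 1" using integrand_bounds[of v r] * by auto
next
  fix r assume *: "r \<in> {a..b}"
  show "continuous_on {0..} (\<lambda>v. v * r / (1 + v * r))"
    by (intro continuous_intros) (use integrand_bounds(2)[OF _ *] in force)
qed measurable

lemma continuous_on_df2: "continuous_on {0..} (df2 M)"
  unfolding df2_def
proof (rule continuous_on_expectation[of _ _ 1])
  fix v r assume *: "v \<in> {0::real..}" "r \<in> {a..b}"
  show "\<bar>(v * r / (1 + v * r))\<^sup>2\<bar> \<le> 1" using integrand_bounds[of v r] * by (simp add: power_le_one)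
next
  fix r assume *: "r \<in> {a..b}"
  show "continuous_on {0..} (\<lambda>v. (v * r / (1 + v * r))\<^sup>2)"
    by (intro continuous_intros) (use integrand_bounds(2)[OF _ *] in force)
qed measurable

lemma continuous_on_unexplained_signal: "continuous_on {0..} (unexplained_signal M)"
  unfolding unexplained_signal_def
proof (rule continuous_on_expectation[of _ _ b])
  fix v r assume *: "v \<in> {0::real..}" "r \<in> {a..b}"
  show "\<bar>r / (1 + v * r)\<^sup>2\<bar> \<le> b" using unexplained_signal_integrand_bounds[of v r] * by auto
next
  fix r assume *: "r \<in> {a..b}"
  show "continuous_on {0..} (\<lambda>v. r / (1 + v * r)\<^sup>2)"
    by (intro continuous_intros) (use integrand_bounds(2)[OF _ *] in force)
qed measurable

lemma df1_ge: "0 \<le> v \<Longrightarrow> v * a / (1 + v * a) \<le> df1 M v"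
  unfolding df1_def by (rule expectation_ge) (use integrand_bounds in auto)

lemma df1_le: "0 \<le> v \<Longrightarrow> df1 M v \<le> v * b / (1 + v * b)"
  unfolding df1_def by (rule expectation_le) (use integrand_bounds in auto)

lemma df1_pos: "0 < v \<Longrightarrow> 0 < df1 M v"
  using df1_ge[of v] a_pos by (smt (verit) divide_pos_pos mult_pos_pos)

lemma df1_less_1: "0 \<le> v \<Longrightarrow> df1 M v < 1"
  using df1_le[of v] b_pos by (smt (verit) divide_less_eq_1 mult_nonneg_nonneg)

text \<open>
  The integrand grows from \<open>v\<close> to \<open>w\<close> by \<open>(w - v) r / ((1 + vr) (1 + wr))\<close>, which is bounded below by a
  positive constant on the support.
\<close>
lemma df1_strict_mono:
  assumes "0 \<le> v" "v < w"
  shows "df1 M v < df1 M w"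
proof -
  define k where "k = (w - v) * a / ((1 + v * b) * (1 + w * b))"
  have "0 < 1 + v * b" "0 < 1 + w * b"
    using assms b_pos by (auto intro!: add_pos_nonneg)
  then have k: "k > 0" using assms a_pos unfolding k_def by simp
  have "df1 M v + k \<le> df1 M w"
    unfolding df1_def
  proof (rule expectation_add_le)
    fix r assume r: "r \<in> {a..b}"
    have p: "0 < 1 + v * r" "0 < 1 + w * r" "0 < r" using integrand_bounds[OF _ r] assms by auto
    have "k \<le> (w - v) * r / ((1 + v * r) * (1 + w * r))"
      unfolding k_def using r p assms a_pos
        integrand_bounds(8)[OF _ r, of v] integrand_bounds(8)[OF _ r, of w]
      by (intro frac_le mult_mono mult_pos_pos) auto
    also have "\<dots> = w * r / (1 + w * r) - v * r / (1 + v * r)"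
      using p by (simp add: divide_simps) (simp add: algebra_simps)
    finally show "v * r / (1 + v * r) + k \<le> w * r / (1 + w * r)" by simp
  qed (use assms in auto)
  with k show ?thesis by simp
qed

text \<open>
  The intermediate value theorem on \<open>[0, t]\<close>, where \<open>t\<close> solves \<open>ta / (1 + ta) = y\<close>: at this \<open>t\<close> the
  pointwise lower bound of the integrand already equals \<open>y\<close>.
\<close>
lemma df1_surj:
  assumes "0 < y" "y < 1"
  shows "\<exists>v>0. df1 M v = y"
proof -
  define t where "t = y / ((1 - y) * a)"
  have t: "t > 0" using assms a_pos unfolding t_def by simp
  have ta: "t * a = y / (1 - y)" using a_pos unfolding t_def by simp
  have "y = t * a / (1 + t * a)" unfolding ta using assms by (simp add: divide_simps)
  then have "y \<le> df1 M t" using df1_ge[of t] t by simp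
  moreover have "df1 M 0 = 0" by (simp add: df1_def)
  moreover have "continuous_on {0..t} (df1 M)"
    by (rule continuous_on_subset[OF continuous_on_df1]) auto
  ultimately obtain v where v: "0 \<le> v" "df1 M v = y"
    using IVT'[of "df1 M" 0 y t] assms t by auto
  then have "v \<noteq> 0" using assms \<open>df1 M 0 = 0\<close> by auto
  with v show ?thesis by (intro exI[of _ v]) auto
qed

lemma df2_nonneg: "0 \<le> df2 M v"
  unfolding df2_def by simp

lemma df2_le_sq:
  assumes "0 \<le> v"
  shows "df2 M v \<le> (v * b)\<^sup>2"
  unfolding df2_def
proof (rule expectation_le)
  fix r assume r: "r \<in> {a..b}"
  have "v * r / (1 + v * r) \<le> v * b / 1"
    using assms r integrand_bounds(1,3)[OF assms r] b_pos by (intro frac_le mult_mono) auto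
  then show "(v * r / (1 + v * r))\<^sup>2 \<le> (v * b)\<^sup>2"
    using integrand_bounds(4)[OF assms r] by (intro power_mono) auto
qed (use assms in auto)

lemma df2_ge: "0 \<le> v \<Longrightarrow> (v * a / (1 + v * a))\<^sup>2 \<le> df2 M v"
  unfolding df2_def
  by (rule expectation_ge) (use integrand_bounds a_pos in \<open>auto intro!: power_mono divide_nonneg_nonneg\<close>)

text \<open>
  The integrand \<open>x = vr / (1 + vr)\<close> satisfies \<open>x - x\<^sup>2 = vr / (1 + vr)\<^sup>2\<close>.  The gap is the denominator
  in the splagging risk: its order \<open>v\<close> near \<open>0\<close> and its decay at \<open>\<infinity>\<close> govern the two ends.
\<close>
lemma df_gap_ge:
  assumes "0 \<le> v"
  shows "df2 M v + v * a / (1 + v * b)\<^sup>2 \<le> df1 M v"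
  unfolding df1_def df2_def
proof (rule expectation_add_le)
  fix r assume r: "r \<in> {a..b}"
  note rb = integrand_bounds[OF assms r]
  have "v * a / (1 + v * b)\<^sup>2 \<le> v * r / (1 + v * r)\<^sup>2"
  proof (rule frac_le)
    show "(1 + v * r)\<^sup>2 \<le> (1 + v * b)\<^sup>2" using rb by (intro power_mono) auto
    show "0 < (1 + v * r)\<^sup>2" using rb(2) by (rule zero_less_power)
  qed (use assms r rb a_pos in \<open>auto intro: mult_left_mono\<close>)
  also have "\<dots> = v * r / (1 + v * r) - (v * r / (1 + v * r))\<^sup>2"
    using rb(2) by (simp add: divide_simps) (simp add: algebra_simps power2_eq_square)
  finally show "(v * r / (1 + v * r))\<^sup>2 + v * a / (1 + v * b)\<^sup>2 \<le> v * r / (1 + v * r)" by simp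
qed (use assms in auto)

lemma df_gap_le:
  assumes "0 \<le> v"
  shows "df1 M v \<le> df2 M v + 1 / (1 + v * a)"
proof -
  have "df1 M v + - (1 / (1 + v * a)) \<le> df2 M v"
    unfolding df1_def df2_def
  proof (rule expectation_add_le)
    fix r assume r: "r \<in> {a..b}"
    note rb = integrand_bounds[OF assms r]
    let ?x = "v * r / (1 + v * r)"
    have "?x - ?x\<^sup>2 = ?x * (1 - ?x)" by (simp add: algebra_simps power2_eq_square)
    also have "\<dots> \<le> 1 * (1 - ?x)" by (rule mult_right_mono) (use rb in auto)
    also have "\<dots> = 1 / (1 + v * r)" using rb(2) by (simp add: divide_simps)
    also have "\<dots> \<le> 1 / (1 + v * a)"
      using assms r a_pos by (intro frac_le) (auto intro!: add_pos_nonneg mult_left_mono)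
    finally show "?x + - (1 / (1 + v * a)) \<le> ?x\<^sup>2" by simp
  qed (use assms in auto)
  then show ?thesis by simp
qed

lemma df2_less_df1: "0 < v \<Longrightarrow> df2 M v < df1 M v"
  using df_gap_ge[of v] a_pos b_pos by (smt (verit) divide_pos_pos mult_pos_pos zero_less_power)

lemma df2_le:
  assumes "0 \<le> v"
  shows "df2 M v + 1 / (1 + v * b) \<le> 1"
proof -
  have "0 \<le> v * a / (1 + v * b)\<^sup>2" using assms a_pos by simp
  then have "df2 M v \<le> v * b / (1 + v * b)" using df_gap_ge[OF assms] df1_le[OF assms] by linarith
  also have "\<dots> = 1 - 1 / (1 + v * b)"
  proof -
    have "0 < 1 + v * b" using assms b_pos by (simp add: add_pos_nonneg)
    then show ?thesis by (simp add: divide_simps)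
  qed
  finally show ?thesis by simp
qed

lemma unexplained_signal_nonneg: "0 \<le> v \<Longrightarrow> 0 \<le> unexplained_signal M v"
  unfolding unexplained_signal_def by (rule expectation_ge) (use unexplained_signal_integrand_bounds in auto)

lemma unexplained_signal_le:
  assumes "0 < v"
  shows "unexplained_signal M v \<le> 1 / (v\<^sup>2 * a)"
  unfolding unexplained_signal_def
proof (rule expectation_le)
  fix r assume r: "r \<in> {a..b}"
  note rb = integrand_bounds[OF less_imp_le[OF assms] r]
  have "r / (1 + v * r)\<^sup>2 \<le> r / (v * r)\<^sup>2"
    using assms rb by (intro frac_le power_mono) auto
  also have "\<dots> = 1 / (v\<^sup>2 * r)" using rb(1) by (simp add: power2_eq_square)
  also have "\<dots> \<le> 1 / (v\<^sup>2 * a)" using assms r a_pos by (intro frac_le) auto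
  finally show "r / (1 + v * r)\<^sup>2 \<le> 1 / (v\<^sup>2 * a)" .
qed (use assms in auto)

text \<open>
  The linear rate at which a positive \<open>v\<close> reduces the bias; it is positive because \<open>a > 0\<close>.
  On \<open>v \<le> 1 / b\<close> one has \<open>vr \<le> 1\<close>, so that the denominator \<open>(1 + vr)\<^sup>2\<close> is at most \<open>4\<close>.
\<close>
lemma unexplained_signal_descent:
  assumes "0 \<le> v" "v \<le> 1 / b"
  shows "unexplained_signal M v + v * a\<^sup>2 / 2 \<le> unexplained_signal M 0"
  unfolding unexplained_signal_def
proof (rule expectation_add_le)
  fix r assume r: "r \<in> {a..b}"
  note rb = integrand_bounds[OF assms(1) r]
  have "v * r \<le> 1"
    using assms r b_pos rb(1) by (smt (verit) mult_left_mono atLeastAtMost_iff pos_le_divide_eq)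
  then have "(1 + v * r)\<^sup>2 \<le> 2\<^sup>2" using rb(2) by (intro power_mono) auto
  then have le4: "(1 + v * r)\<^sup>2 \<le> 4" by simp
  have "v * a\<^sup>2 / 2 = 2 * v * a\<^sup>2 / 4" by simp
  also have "\<dots> \<le> 2 * v * r\<^sup>2 / (1 + v * r)\<^sup>2"
  proof (rule frac_le)
    show "2 * v * a\<^sup>2 \<le> 2 * v * r\<^sup>2"
      using assms r a_pos by (intro mult_left_mono power_mono) auto
    show "0 < (1 + v * r)\<^sup>2" using rb(2) by (rule zero_less_power)
  qed (use assms rb le4 in auto)
  also have "\<dots> \<le> (2 * v * r\<^sup>2 + v\<^sup>2 * r ^ 3) / (1 + v * r)\<^sup>2"
    using rb assms by (intro divide_right_mono) auto
  also have "\<dots> = r - r / (1 + v * r)\<^sup>2"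
    using rb(2) by (simp add: divide_simps) (simp add: algebra_simps power2_eq_square power3_eq_cube)
  finally show "r / (1 + v * r)\<^sup>2 + v * a\<^sup>2 / 2 \<le> r / (1 + 0 * r)\<^sup>2" by simp
qed (use assms integrable_unexplained_signal[of 0] in auto)

lemma unexplained_signal_0: "unexplained_signal M 0 = expectation (\<lambda>r. r)"
  by (simp add: unexplained_signal_def)

text \<open>
  First-order gain against second-order cost: the bias drops by a multiple of \<open>v\<close>, whereas the factor
  \<open>F\<close> costs only a multiple of \<open>v\<^sup>2\<close>.  The bound \<open>F \<ge> 1\<close> keeps the risk near \<open>0\<close> above a number that
  exceeds the value at the interior point, so that the infimum is not approached at \<open>0\<close>.
\<close>
lemma interior_beats_null:
  assumes s: "0 \<le> s" and p: "0 < p" and K: "0 \<le> K" and V: "0 < V"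
    and F: "eventually (\<lambda>v. 1 \<le> F v \<and> F v \<le> 1 + K * v\<^sup>2) (at_right 0)"
  defines "R \<equiv> \<lambda>v. (s + p * unexplained_signal M v) * F v"
  shows "\<exists>u. 0 < u \<and> u \<le> V \<and> R u < s + p * unexplained_signal M 0 \<and>
           eventually (\<lambda>v. R u \<le> R v) (at_right 0)"
proof -
  define A where "A = s + p * unexplained_signal M 0"
  define k where "k = p * a\<^sup>2 / 2"
  have k: "k > 0" using p a_pos by (simp add: k_def)
  have "((\<lambda>v. A * K * v) \<longlongrightarrow> A * K * 0) (at_right 0)" by (intro tendsto_intros)
  then have ev1: "eventually (\<lambda>v. A * K * v < k) (at_right 0)"
    using k by (auto dest: order_tendstoD(2))
  have b_inv: "0 < 1 / b" using b_pos by simp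
  have "eventually (\<lambda>v. 0 < v \<and> v < V \<and> R v < A) (at_right 0)"
    using F ev1 eventually_small[OF V] eventually_small[OF b_inv]
  proof eventually_elim
    case (elim v)
    have v: "0 < v" "v \<le> 1 / b" "A * K * v < k" using elim b_pos by auto
    have "p * (unexplained_signal M v + v * a\<^sup>2 / 2) \<le> p * unexplained_signal M 0"
      using unexplained_signal_descent[of v] v p by (intro mult_left_mono) auto
    then have le: "s + p * unexplained_signal M v \<le> A - k * v"
      by (simp add: A_def k_def algebra_simps)
    have nn: "0 \<le> s + p * unexplained_signal M v" using unexplained_signal_nonneg[of v] v s p by simp
    have "R v \<le> (s + p * unexplained_signal M v) * (1 + K * v\<^sup>2)"
      unfolding R_def using elim nn by (intro mult_left_mono) auto
    also have "\<dots> \<le> (A - k * v) * (1 + K * v\<^sup>2)"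
      using le K by (intro mult_right_mono) auto
    also have "\<dots> = A - v * (k - A * K * v) - k * K * v ^ 3"
      by (simp add: algebra_simps power2_eq_square power3_eq_cube)
    also have "\<dots> < A"
    proof -
      have "0 < v * (k - A * K * v)" using v by simp
      moreover have "0 \<le> k * K * v ^ 3" using v k K by simp
      ultimately show ?thesis by linarith
    qed
    finally show ?case using v elim by simp
  qed
  then obtain u where u: "0 < u" "u < V" "R u < A"
    using eventually_happens'[OF trivial_limit_at_right_real] by blast
  have "(unexplained_signal M \<longlongrightarrow> unexplained_signal M 0) (at 0 within {0..})"
    using continuous_on_unexplained_signal by (auto simp: continuous_on)
  then have "(unexplained_signal M \<longlongrightarrow> unexplained_signal M 0) (at_right 0)"
    by (rule tendsto_within_subset) auto
  then have "((\<lambda>v. s + p * unexplained_signal M v) \<longlongrightarrow> A) (at_right 0)"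
    unfolding A_def by (intro tendsto_intros)
  then have "eventually (\<lambda>v. R u < s + p * unexplained_signal M v) (at_right 0)"
    using u(3) by (auto dest: order_tendstoD(1))
  then have "eventually (\<lambda>v. R u \<le> R v) (at_right 0)"
    using F eventually_at_right_less[of "0::real"]
  proof eventually_elim
    case (elim v)
    have nn: "0 \<le> s + p * unexplained_signal M v" using unexplained_signal_nonneg[of v] elim s p by simp
    have "(s + p * unexplained_signal M v) * 1 \<le> R v"
      unfolding R_def using elim nn by (intro mult_left_mono) auto
    then show ?case using elim by simp
  qed
  with u show ?thesis unfolding A_def by (intro exI[of _ u]) auto
qed

text \<open>
  Multiplied by \<open>v\<close>, the fixed-point equation at \<open>\<theta>\<close> reads \<open>df1 M v = 1 / \<theta>\<close>; uniqueness is the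
  injectivity of \<open>df1\<close>.
\<close>
lemma v0_eq:
  assumes "0 < v"
  shows "v0 M (1 / df1 M v) = v"
  unfolding v0_def
proof (rule the_equality)
  have df1: "df1 M w = w * expectation (\<lambda>r. r / (1 + w * r))" for w
    unfolding df1_def by (subst integral_mult_right_zero[symmetric]) simp
  have iff: "1 / w = 1 / df1 M v * expectation (\<lambda>r. r / (1 + w * r)) \<longleftrightarrow> df1 M w = df1 M v"
    if "0 < w" for w
    using that df1_pos[OF assms] unfolding df1[of w] by (auto simp: field_simps)
  show "0 < v \<and> 1 / v = 1 / df1 M v * expectation (\<lambda>r. r / (1 + v * r))"
    using iff assms by blast
  fix w assume "0 < w \<and> 1 / w = 1 / df1 M v * expectation (\<lambda>r. r / (1 + w * r))"
  then have "0 < w" "df1 M w = df1 M v" using iff by auto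
  then show "w = v"
    using df1_strict_mono[of v w] df1_strict_mono[of w v] assms by (cases v w rule: linorder_cases) auto
qed

lemma tilde_v0_eq:
  assumes "0 < v"
  shows "tilde_v0 M (ereal \<tau>) (ereal (1 / df1 M v)) = \<tau> * df2 M v / (1 - \<tau> * df2 M v)"
proof -
  have "df2 M v = expectation (\<lambda>r. v\<^sup>2 * (r\<^sup>2 / (1 + v * r)\<^sup>2))"
    unfolding df2_def by (simp add: power_divide power_mult_distrib)
  also have "\<dots> = v\<^sup>2 * expectation (\<lambda>r. r\<^sup>2 / (1 + v * r)\<^sup>2)"
    by (rule integral_mult_right_zero)
  finally have "expectation (\<lambda>r. r\<^sup>2 / (1 + v * r)\<^sup>2) = df2 M v / v\<^sup>2"
    using assms by simp
  moreover have "(\<tau> * (x / v\<^sup>2)) / (1 / v\<^sup>2 - \<tau> * (x / v\<^sup>2)) = \<tau> * x / (1 - \<tau> * x)" for x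
  proof -
    have "1 / v\<^sup>2 - \<tau> * (x / v\<^sup>2) = (1 - \<tau> * x) / v\<^sup>2" by (simp add: diff_divide_distrib)
    then show ?thesis using assms by simp
  qed
  ultimately show ?thesis by (simp add: tilde_v0_def v0_eq[OF assms])
qed

end

section \<open>The risks as functions of the fixed point\<close>

locale proportional_limit = H: spectral_law H a b + G: spectral_law G a b
  for H G :: "real measure" and a b :: real +
  fixes rho2 sigma2 \<phi> :: real
  assumes rho2_nonneg: "0 \<le> rho2" and sigma2_nonneg: "0 \<le> sigma2" and \<phi>_pos: "0 < \<phi>"
begin

text \<open>
  The fixed points \<open>v(0;\<theta>)\<close> of the aspect ratios \<open>\<theta> \<in> (1, \<infinity>)\<close> with \<open>\<theta> \<ge> \<phi>\<close>.
\<close>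
definition admissible :: "real set" where
  "admissible = {v. 0 < v \<and> \<phi> * df1 H v \<le> 1}"

definition aspect_ratio :: "real \<Rightarrow> ereal" where
  "aspect_ratio v = ereal (1 / df1 H v)"

text \<open>
  The factors by which the risks of subagging and splagging exceed \<open>\<sigma>\<^sup>2 + C\<^sub>0\<close>, the risk of averaging
  infinitely many predictors trained on independent data.
\<close>
definition sub_factor :: "real \<Rightarrow> real" where
  "sub_factor v = 1 / (1 - \<phi> * df2 H v)"

definition spl_factor :: "real \<Rightarrow> real" where
  "spl_factor v = 1 + \<phi> * df1 H v * df2 H v / (df1 H v - df2 H v)"

definition independent_risk :: "real \<Rightarrow> real" where
  "independent_risk v = sigma2 + rho2 * unexplained_signal G v"

lemma admissible_le_1: "\<phi> \<le> 1 \<Longrightarrow> admissible = {0<..}"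
proof -
  assume "\<phi> \<le> 1"
  then have "\<phi> * df1 H v \<le> 1 * 1" if "0 < v" for v
    using that H.df1_less_1[of v] H.df1_pos[OF that] by (intro mult_mono) auto
  then show ?thesis by (auto simp: admissible_def)
qed

lemma admissible_gt_1:
  assumes "1 < \<phi>"
  shows "\<exists>V>0. admissible = {0<..V}"
proof -
  obtain V where V: "V > 0" "df1 H V = 1 / \<phi>" using H.df1_surj[of "1 / \<phi>"] assms by auto
  have "\<phi> * df1 H v \<le> 1 \<longleftrightarrow> v \<le> V" if "0 < v" for v
  proof -
    have "\<phi> * df1 H v \<le> 1 \<longleftrightarrow> df1 H v \<le> df1 H V"
      unfolding V(2) using assms by (simp add: field_simps)
    also have "\<dots> \<longleftrightarrow> v \<le> V"
      using H.df1_strict_mono[of v V] H.df1_strict_mono[of V v] that V(1)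
      by (cases v V rule: linorder_cases) auto
    finally show ?thesis .
  qed
  then show ?thesis using V(1) by (intro exI[of _ V]) (auto simp: admissible_def)
qed

lemma aspect_ratio_in_range:
  assumes "v \<in> admissible"
  shows "1 < aspect_ratio v" "aspect_ratio v < \<infinity>" "ereal \<phi> \<le> aspect_ratio v"
  using assms H.df1_pos[of v] H.df1_less_1[of v]
  by (auto simp: admissible_def aspect_ratio_def field_simps one_ereal_def)

lemma aspect_ratio_cases:
  assumes "x \<in> {ereal \<phi>..\<infinity>}"
  shows "x \<le> 1 \<or> x = \<infinity> \<or> (\<exists>v\<in>admissible. x = aspect_ratio v)"
proof (cases x)
  case (real \<theta>)
  show ?thesis
  proof (cases "\<theta> \<le> 1")
    case False
    then obtain v where v: "v > 0" "df1 H v = 1 / \<theta>" using H.df1_surj[of "1 / \<theta>"] by auto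
    then have "v \<in> admissible" "x = aspect_ratio v"
      using False assms real by (auto simp: admissible_def aspect_ratio_def)
    then show ?thesis by blast
  qed (use real in \<open>auto simp: one_ereal_def\<close>)
qed (use assms in auto)

text \<open>
  Since \<open>df2 < df1\<close> and \<open>\<phi> df1 \<le> 1\<close>, the denominator of the subagging risk cannot vanish.
\<close>
lemma admissible_df2_less: "v \<in> admissible \<Longrightarrow> \<phi> * df2 H v < 1"
  using H.df2_less_df1[of v] \<phi>_pos unfolding admissible_def
  by (smt (verit) mem_Collect_eq mult_strict_left_mono)

lemma tilde_c0_aspect_ratio: "v \<in> admissible \<Longrightarrow> tilde_c0 H G (aspect_ratio v) = unexplained_signal G v"
  by (simp add: tilde_c0_def aspect_ratio_def H.v0_eq admissible_def unexplained_signal_def)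

lemma risk_sub_aspect_ratio:
  assumes "v \<in> admissible"
  shows "risk_sub H G rho2 sigma2 \<phi> (aspect_ratio v) = ereal (independent_risk v * sub_factor v)"
proof -
  have tv: "tilde_v0 H (ereal \<phi>) (aspect_ratio v) = \<phi> * df2 H v / (1 - \<phi> * df2 H v)"
    unfolding aspect_ratio_def by (rule H.tilde_v0_eq) (use assms in \<open>simp add: admissible_def\<close>)
  note aspect_ratio_in_range[OF assms]
  then have "risk_sub H G rho2 sigma2 \<phi> (aspect_ratio v) =
    ereal (sigma2 + rho2 * (1 + \<phi> * df2 H v / (1 - \<phi> * df2 H v)) * unexplained_signal G v
       + sigma2 * (\<phi> * df2 H v / (1 - \<phi> * df2 H v)))"
    unfolding risk_sub_def B0_def V0_def tv tilde_c0_aspect_ratio[OF assms] by auto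
  also have "\<dots> = ereal (independent_risk v * sub_factor v)"
    unfolding independent_risk_def sub_factor_def using admissible_df2_less[OF assms]
    by (simp add: divide_simps) (simp add: algebra_simps)
  finally show ?thesis .
qed

lemma risk_spl_aspect_ratio:
  assumes "v \<in> admissible"
  shows "risk_spl H G rho2 sigma2 \<phi> (aspect_ratio v) = ereal (independent_risk v * spl_factor v)"
proof -
  have v: "0 < v" using assms by (simp add: admissible_def)
  have gap: "0 < df1 H v" "df2 H v < df1 H v" using H.df1_pos[OF v] H.df2_less_df1[OF v] by auto
  have "tilde_v0 H (aspect_ratio v) (aspect_ratio v) = 1 / df1 H v * df2 H v / (1 - 1 / df1 H v * df2 H v)"
    unfolding aspect_ratio_def by (rule H.tilde_v0_eq[OF v])
  also have "\<dots> = df2 H v / (df1 H v - df2 H v)"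
    using gap by (simp add: divide_simps)
  finally have tv: "tilde_v0 H (aspect_ratio v) (aspect_ratio v) = df2 H v / (df1 H v - df2 H v)" .
  have q: "ereal \<phi> / aspect_ratio v = ereal (\<phi> * df1 H v)" using gap by (simp add: aspect_ratio_def)
  note aspect_ratio_in_range[OF assms]
  then have "risk_spl H G rho2 sigma2 \<phi> (aspect_ratio v) =
    ereal (sigma2 + \<phi> * df1 H v * (rho2 * (1 + df2 H v / (df1 H v - df2 H v)) * unexplained_signal G v
       + sigma2 * (df2 H v / (df1 H v - df2 H v))) + (1 - \<phi> * df1 H v) * (rho2 * unexplained_signal G v))"
    unfolding risk_spl_def B0_def V0_def C0_def tv q tilde_c0_aspect_ratio[OF assms]
    by (auto simp: one_ereal_def)
  also have "\<dots> = ereal (independent_risk v * spl_factor v)"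
    unfolding independent_risk_def spl_factor_def using gap
    by (simp add: divide_simps) (simp add: algebra_simps)
  finally show ?thesis .
qed

lemma risk_infinity:
  "risk_sub H G rho2 sigma2 \<phi> \<infinity> = ereal (independent_risk 0)"
  "risk_spl H G rho2 sigma2 \<phi> \<infinity> = ereal (independent_risk 0)"
  by (auto simp: risk_sub_def risk_spl_def B0_def V0_def C0_def tilde_v0_def tilde_c0_def
      independent_risk_def G.unexplained_signal_0)

lemma independent_risk_ge: "0 \<le> v \<Longrightarrow> sigma2 \<le> independent_risk v"
  unfolding independent_risk_def using rho2_nonneg G.unexplained_signal_nonneg by simp

lemma sub_factor_ge_1: "v \<in> admissible \<Longrightarrow> 1 \<le> sub_factor v"
  unfolding sub_factor_def
  using admissible_df2_less[of v] H.df2_nonneg[of v] \<phi>_pos by (simp add: le_divide_eq)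

lemma spl_factor_ge_1: "0 < v \<Longrightarrow> 1 \<le> spl_factor v"
  unfolding spl_factor_def
  using H.df2_less_df1[of v] H.df2_nonneg[of v] H.df1_pos[of v] \<phi>_pos by simp

lemma admissible_small: "0 < v \<Longrightarrow> v < 1 / (\<phi> * b) \<Longrightarrow> v \<in> admissible"
proof -
  assume v: "0 < v" "v < 1 / (\<phi> * b)"
  have "0 < v * b" using v H.b_pos by simp
  then have "v * b / (1 + v * b) \<le> v * b" by (simp add: divide_le_eq mult_le_cancel_left1)
  then have "df1 H v \<le> v * b" using H.df1_le[of v] v by simp
  then have "\<phi> * df1 H v \<le> \<phi> * (v * b)" using \<phi>_pos by simp
  also have "\<dots> \<le> 1" using v(2) \<phi>_pos H.b_pos by (simp add: field_simps)
  finally show ?thesis using v by (simp add: admissible_def)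
qed

section \<open>Behaviour near the null predictor\<close>

lemma sub_factor_near_0:
  "eventually (\<lambda>v. 1 \<le> sub_factor v \<and> sub_factor v \<le> 1 + 2 * \<phi> * b\<^sup>2 * v\<^sup>2) (at_right 0)"
proof -
  have "((\<lambda>v. \<phi> * (v * b)\<^sup>2) \<longlongrightarrow> \<phi> * (0 * b)\<^sup>2) (at_right 0)" by (intro tendsto_intros)
  then have "eventually (\<lambda>v. \<phi> * (v * b)\<^sup>2 < 1 / 2) (at_right 0)"
    by (auto dest: order_tendstoD(2)[where a = "1/2"])
  moreover have "0 < 1 / (\<phi> * b)" using \<phi>_pos H.b_pos by simp
  note eventually_small[OF this]
  ultimately show ?thesis
  proof eventually_elim
    case (elim v)
    then have v: "v \<in> admissible" "0 \<le> v" using admissible_small by auto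
    let ?q = "\<phi> * (v * b)\<^sup>2"
    have "\<phi> * df2 H v \<le> ?q" using H.df2_le_sq[OF v(2)] \<phi>_pos by simp
    then have "sub_factor v \<le> 1 / (1 - ?q)"
      unfolding sub_factor_def using elim by (intro divide_left_mono) auto
    \<comment> \<open>The geometric series bound, valid because \<open>?q < 1 / 2\<close>.\<close>
    also have "\<dots> \<le> 1 + 2 * ?q"
    proof -
      have "0 \<le> ?q * (1 - 2 * ?q)" using elim \<phi>_pos by (intro mult_nonneg_nonneg) auto
      then have "1 \<le> (1 + 2 * ?q) * (1 - ?q)" by (simp add: algebra_simps)
      then show ?thesis using elim by (simp add: divide_le_eq)
    qed
    finally show ?case using sub_factor_ge_1[OF v(1)] by (simp add: power_mult_distrib algebra_simps)
  qed
qed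

text \<open>
  Although \<open>df1 - df2\<close> vanishes at \<open>0\<close>, it does so only linearly, against the cubic order of
  \<open>df1 * df2\<close>.
\<close>
lemma spl_factor_near_0:
  "eventually (\<lambda>v. 1 \<le> spl_factor v \<and> spl_factor v \<le> 1 + 4 * \<phi> * b ^ 3 / a * v\<^sup>2) (at_right 0)"
proof -
  have "0 < 1 / b" using H.b_pos by simp
  note eventually_small[OF this]
  then show ?thesis
  proof eventually_elim
    case (elim v)
    have v: "0 < v" "0 < v * b" "v * b \<le> 1" using elim H.b_pos by (auto simp: field_simps)
    have "v * b / (1 + v * b) \<le> v * b" using v by (simp add: divide_le_eq mult_le_cancel_left1)
    then have m: "df1 H v \<le> v * b" using H.df1_le[of v] v by simp
    have "(1 + v * b)\<^sup>2 \<le> 2\<^sup>2" using v by (intro power_mono) auto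
    then have "v * a / 4 \<le> v * a / (1 + v * b)\<^sup>2"
      using v H.a_pos by (intro divide_left_mono) auto
    then have gap: "v * a / 4 \<le> df1 H v - df2 H v" using H.df_gap_ge[of v] v by linarith
    have "\<phi> * df1 H v * df2 H v / (df1 H v - df2 H v) \<le> \<phi> * (v * b) * (v * b)\<^sup>2 / (v * a / 4)"
      using gap m v \<phi>_pos H.a_pos H.df2_le_sq[of v] H.df2_nonneg[of v] H.df1_pos[of v]
      by (intro frac_le mult_mono) auto
    also have "\<dots> = 4 * \<phi> * b ^ 3 / a * v\<^sup>2"
      using v by (simp add: field_simps power2_eq_square power3_eq_cube)
    finally show ?case using spl_factor_ge_1[OF v(1)] by (simp add: spl_factor_def)
  qed
qed

section \<open>Minimisation over the overparametrised regime\<close>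

lemma continuous_on_independent_risk: "continuous_on admissible independent_risk"
  unfolding independent_risk_def
  by (intro continuous_intros continuous_on_subset[OF G.continuous_on_unexplained_signal])
    (auto simp: admissible_def)

lemma continuous_on_sub_factor: "continuous_on admissible sub_factor"
  unfolding sub_factor_def
  by (intro continuous_intros continuous_on_subset[OF H.continuous_on_df2])
    (use admissible_df2_less in \<open>fastforce simp: admissible_def\<close>)+

lemma continuous_on_spl_factor: "continuous_on admissible spl_factor"
  unfolding spl_factor_def
  by (intro continuous_intros continuous_on_subset[OF H.continuous_on_df2]
      continuous_on_subset[OF H.continuous_on_df1])
    (use H.df2_less_df1 in \<open>fastforce simp: admissible_def\<close>)+

text \<open>
  Both risks are handled at once, with \<open>F\<close> one of the two factors.  For \<open>\<phi> > 1\<close> the admissible set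
  contains its right end point, so only the end \<open>0\<close> needs control; for \<open>\<phi> \<le> 1\<close> the value at \<open>t\<close> keeps
  the infimum away from \<open>\<infinity>\<close>.
\<close>
lemma attains_min_admissible:
  assumes rho2: "0 < rho2" and K: "0 \<le> K"
    and F: "eventually (\<lambda>v. 1 \<le> F v \<and> F v \<le> 1 + K * v\<^sup>2) (at_right 0)"
    and cont: "continuous_on admissible F"
    and endinf: "\<phi> \<le> 1 \<Longrightarrow> \<exists>t>0. eventually (\<lambda>v. independent_risk t * F t \<le> independent_risk v * F v) at_top"
  shows "\<exists>v\<in>admissible. (\<forall>w\<in>admissible. independent_risk v * F v \<le> independent_risk w * F w) \<and>
    independent_risk v * F v < independent_risk 0"
proof -
  define R where "R = (\<lambda>v. independent_risk v * F v)"
  have R: "R = (\<lambda>v. (sigma2 + rho2 * unexplained_signal G v) * F v)"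
    by (simp add: R_def independent_risk_def)
  have contR: "continuous_on admissible R"
    unfolding R_def by (intro continuous_intros continuous_on_independent_risk cont)
  have u: "\<exists>u. 0 < u \<and> u \<le> V \<and> R u < independent_risk 0 \<and> eventually (\<lambda>v. R u \<le> R v) (at_right 0)"
    if "0 < V" for V
    using G.interior_beats_null[OF sigma2_nonneg rho2 K that F] unfolding R independent_risk_def by simp
  have "\<exists>u\<in>admissible. R u < independent_risk 0 \<and> (\<exists>v\<in>admissible. \<forall>w\<in>admissible. R v \<le> R w)"
  proof (cases "\<phi> \<le> 1")
    case True
    note S = admissible_le_1[OF True]
    obtain u where u: "0 < u" "R u < independent_risk 0" "eventually (\<lambda>v. R u \<le> R v) (at_right 0)"
      using u[of 1] by auto
    obtain t where "t > 0" "eventually (\<lambda>v. R t \<le> R v) at_top"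
      using endinf[OF True] unfolding R_def by auto
    then have "\<exists>v\<in>{0<..}. \<forall>w\<in>{0<..}. R v \<le> R w"
      using attains_min_Ioi[of R u t] contR u unfolding S by auto
    then show ?thesis unfolding S using u by auto
  next
    case False
    then obtain V where V: "V > 0" and S: "admissible = {0<..V}" using admissible_gt_1 by auto
    obtain u where u: "0 < u" "u \<le> V" "R u < independent_risk 0" "eventually (\<lambda>v. R u \<le> R v) (at_right 0)"
      using u[OF V] by auto
    then have "\<exists>v\<in>{0<..V}. \<forall>w\<in>{0<..V}. R v \<le> R w"
      using attains_min_Ioc[of V R u] contR unfolding S by auto
    then show ?thesis unfolding S using u by auto
  qed
  then show ?thesis unfolding R_def by (meson le_less_trans)
qed

section \<open>Behaviour near the interpolation threshold\<close>

lemma sub_factor_ge: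
  assumes "v \<in> admissible"
  shows "1 / (1 - \<phi> * (v * a / (1 + v * a))\<^sup>2) \<le> sub_factor v"
proof -
  have "\<phi> * (v * a / (1 + v * a))\<^sup>2 \<le> \<phi> * df2 H v"
    using H.df2_ge[of v] assms \<phi>_pos by (simp add: admissible_def)
  with admissible_df2_less[OF assms] show ?thesis
    unfolding sub_factor_def by (intro divide_left_mono) auto
qed

text \<open>
  The value \<open>\<sigma>\<^sup>2 / (1 - \<phi>)\<close> is the subagging risk throughout the underparametrised regime and its
  limit as \<open>t \<rightarrow> \<infinity>\<close>.  For large \<open>t\<close> the variance saves \<open>\<sigma>\<^sup>2 \<phi> (1 - df2) \<ge> \<sigma>\<^sup>2 \<phi> / (1 + tb)\<close>, which dominates
  the bias of order \<open>1 / t\<^sup>2\<close>.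
\<close>
lemma sub_beats_underparam:
  assumes "\<phi> < 1" "0 < sigma2"
  shows "\<exists>t>0. independent_risk t * sub_factor t < sigma2 / (1 - \<phi>)"
proof -
  have ab: "a > 0" "b > 0" using H.a_pos H.b_pos by auto
  \<comment> \<open>Bias of order \<open>1 / t\<^sup>2\<close> on the left, saved variance of order \<open>1 / t\<close> on the right.\<close>
  have "eventually (\<lambda>t. rho2 / (t\<^sup>2 * a) * (1 - \<phi>) < sigma2 * \<phi> / (1 + t * b)) at_top"
    using ab \<phi>_pos assms by real_asymp
  then have "eventually (\<lambda>t. 0 < t \<and> rho2 / (t\<^sup>2 * a) * (1 - \<phi>) < sigma2 * \<phi> / (1 + t * b)) at_top"
    using eventually_gt_at_top[of 0] by (auto intro: eventually_conj)
  then obtain t where t: "0 < t" "rho2 / (t\<^sup>2 * a) * (1 - \<phi>) < sigma2 * \<phi> / (1 + t * b)"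
    using eventually_happens'[OF trivial_limit_at_top_linorder] by blast
  have "independent_risk t \<le> sigma2 + rho2 / (t\<^sup>2 * a)"
    using mult_left_mono[OF G.unexplained_signal_le[OF t(1)] rho2_nonneg] by (simp add: independent_risk_def)
  then have "independent_risk t * (1 - \<phi>) \<le> (sigma2 + rho2 / (t\<^sup>2 * a)) * (1 - \<phi>)"
    using assms by (intro mult_right_mono) auto
  also have "\<dots> < sigma2 * (1 - \<phi> + \<phi> / (1 + t * b))"
    using t(2) by (simp add: algebra_simps)
  also have "\<dots> \<le> sigma2 * (1 - \<phi> * df2 H t)"
  proof -
    have "\<phi> * (df2 H t + 1 / (1 + t * b)) \<le> \<phi> * 1"
      using H.df2_le[of t] t \<phi>_pos by (intro mult_left_mono) auto
    then show ?thesis using assms by (intro mult_left_mono) (auto simp: algebra_simps)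
  qed
  finally have "independent_risk t * (1 - \<phi>) < sigma2 * (1 - \<phi> * df2 H t)" .
  moreover have "0 < 1 - \<phi> * df2 H t"
    using admissible_df2_less[of t] admissible_le_1 assms t by auto
  ultimately have "independent_risk t * sub_factor t < sigma2 / (1 - \<phi>)"
    unfolding sub_factor_def using assms by (simp add: field_simps)
  with t show ?thesis by blast
qed

text \<open>
  The minorant \<open>?g\<close> replaces \<open>df2\<close> by its pointwise lower bound and drops the bias.  It tends to
  \<open>\<sigma>\<^sup>2 / (1 - \<phi>)\<close>, a value already undercut, or to \<open>\<infinity>\<close> if \<open>\<phi> = 1\<close>.
\<close>
lemma risk_sub_exceeds_value_at_top:
  assumes "\<phi> \<le> 1" "0 < sigma2"
  shows "\<exists>t>0. eventually (\<lambda>v. independent_risk t * sub_factor t \<le> independent_risk v * sub_factor v) at_top"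
proof -
  have a: "a > 0" using H.a_pos by auto
  let ?g = "\<lambda>v. sigma2 * (1 / (1 - \<phi> * (v * a / (1 + v * a))\<^sup>2))"
  have le: "eventually (\<lambda>v. ?g v \<le> independent_risk v * sub_factor v) at_top"
    using eventually_gt_at_top[of 0]
  proof eventually_elim
    case (elim v)
    then have v: "v \<in> admissible" using admissible_le_1 assms by auto
    show ?case
      using independent_risk_ge[of v] sub_factor_ge[OF v] sub_factor_ge_1[OF v] elim sigma2_nonneg
      by (intro order_trans[OF mult_left_mono[OF _ sigma2_nonneg] mult_right_mono]) auto
  qed
  have "\<exists>t>0. eventually (\<lambda>v. independent_risk t * sub_factor t < ?g v) at_top"
  proof (cases "\<phi> < 1")
    case True
    obtain t where t: "t > 0" "independent_risk t * sub_factor t < sigma2 / (1 - \<phi>)"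
      using sub_beats_underparam[OF True assms(2)] by auto
    have "(?g \<longlongrightarrow> sigma2 / (1 - \<phi>)) at_top"
      using a True by real_asymp (simp add: divide_inverse)
    then show ?thesis using t by (auto dest: order_tendstoD(1))
  next
    case False
    then have "\<phi> = 1" using assms by simp
    then have "filterlim ?g at_top at_top"
      using a assms by simp real_asymp
    then show ?thesis
      by (intro exI[of _ 1]) (auto simp: filterlim_at_top_dense)
  qed
  then obtain t where t: "t > 0" "eventually (\<lambda>v. independent_risk t * sub_factor t < ?g v) at_top" by auto
  have "eventually (\<lambda>v. independent_risk t * sub_factor t \<le> independent_risk v * sub_factor v) at_top"
    using t(2) le by eventually_elim auto
  with t(1) show ?thesis by blast
qed

text \<open>
  Replacing \<open>df1\<close>, \<open>df2\<close> and the gap by their pointwise bounds gives a minorant that grows linearly in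
  \<open>v\<close>, so that any \<open>t\<close> will do.
\<close>
lemma risk_spl_exceeds_value_at_top:
  assumes "0 < sigma2"
  shows "\<exists>t>0. eventually (\<lambda>v. independent_risk t * spl_factor t \<le> independent_risk v * spl_factor v) at_top"
proof -
  have a: "a > 0" using H.a_pos by auto
  let ?y = "\<lambda>v. v * a / (1 + v * a)"
  let ?g = "\<lambda>v. sigma2 * (\<phi> * ?y v * (?y v)\<^sup>2 / (1 / (1 + v * a)))"
  have le: "eventually (\<lambda>v. ?g v \<le> independent_risk v * spl_factor v) at_top"
    using eventually_gt_at_top[of 0]
  proof eventually_elim
    case (elim v)
    have y: "0 \<le> ?y v" using elim a by simp
    have "\<phi> * ?y v * (?y v)\<^sup>2 / (1 / (1 + v * a)) \<le> \<phi> * df1 H v * df2 H v / (df1 H v - df2 H v)"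
      using H.df1_ge[of v] H.df2_ge[of v] H.df_gap_le[of v] H.df2_less_df1[of v] H.df1_pos[of v]
        H.df2_nonneg[of v] elim \<phi>_pos y
      by (intro frac_le mult_mono) auto
    then have "\<phi> * ?y v * (?y v)\<^sup>2 / (1 / (1 + v * a)) \<le> spl_factor v"
      by (simp add: spl_factor_def)
    then show ?case
      using independent_risk_ge[of v] spl_factor_ge_1[OF elim] elim sigma2_nonneg
      by (intro order_trans[OF mult_left_mono[OF _ sigma2_nonneg] mult_right_mono]) auto
  qed
  have "filterlim ?g at_top at_top"
    using a assms \<phi>_pos by real_asymp
  then have "eventually (\<lambda>v. independent_risk 1 * spl_factor 1 < ?g v) at_top"
    by (auto simp: filterlim_at_top_dense)
  then have "eventually (\<lambda>v. independent_risk 1 * spl_factor 1 \<le> independent_risk v * spl_factor v) at_top"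
    using le by eventually_elim auto
  then show ?thesis by (intro exI[of _ 1]) auto
qed

section \<open>Global minimisers\<close>

lemma global_min_at_aspect_ratio:
  assumes finf: "f \<infinity> = ereal (independent_risk 0)"
    and f: "\<And>w. w \<in> admissible \<Longrightarrow> f (aspect_ratio w) = ereal (R w)"
    and v: "v \<in> admissible" "\<forall>w\<in>admissible. R v \<le> R w" "R v < independent_risk 0"
    and under: "\<And>x. ereal \<phi> \<le> x \<Longrightarrow> x \<le> 1 \<Longrightarrow> ereal (R v) \<le> f x"
  shows "global_min_at f \<phi> (aspect_ratio v)"
  unfolding is_arg_min_linorder
proof (intro conjI allI impI)
  show "aspect_ratio v \<in> {ereal \<phi>..\<infinity>}" using aspect_ratio_in_range(3)[OF v(1)] by simp
  fix x assume x: "x \<in> {ereal \<phi>..\<infinity>}"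
  consider "x \<le> 1" | "x = \<infinity>" | w where "w \<in> admissible" "x = aspect_ratio w"
    using aspect_ratio_cases[OF x] by blast
  then show "f (aspect_ratio v) \<le> f x"
    by cases (use under x f v finf in auto)
qed

text \<open>
  If \<open>\<phi> > 1\<close> there is nothing to compare with on \<open>[\<phi>, 1]\<close>.  Otherwise the noise makes the risk infinite at
  \<open>1\<close>, and on \<open>[\<phi>, 1)\<close> the risk is the constant \<open>\<sigma>\<^sup>2 / (1 - \<phi>)\<close>.
\<close>
lemma risk_sub_minimizer:
  assumes "0 < rho2" "1 < \<phi> \<or> 0 < sigma2"
  shows "\<exists>x\<in>{1<..<\<infinity>}. ereal \<phi> \<le> x \<and> global_min_at (risk_sub H G rho2 sigma2 \<phi>) \<phi> x"
proof -
  obtain v where v: "v \<in> admissible"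
      "\<forall>w\<in>admissible. independent_risk v * sub_factor v \<le> independent_risk w * sub_factor w"
      "independent_risk v * sub_factor v < independent_risk 0"
    using attains_min_admissible[OF assms(1) _ sub_factor_near_0 continuous_on_sub_factor]
      risk_sub_exceeds_value_at_top assms
      \<phi>_pos by auto
  have "global_min_at (risk_sub H G rho2 sigma2 \<phi>) \<phi> (aspect_ratio v)"
  proof (rule global_min_at_aspect_ratio[OF risk_infinity(1) risk_sub_aspect_ratio v])
    fix x assume x: "ereal \<phi> \<le> x" "x \<le> 1"
    then have "ereal \<phi> \<le> 1" by (rule order_trans)
    then have "\<phi> \<le> 1" by (simp add: one_ereal_def)
    then have s: "0 < sigma2" using assms by auto
    show "ereal (independent_risk v * sub_factor v) \<le> risk_sub H G rho2 sigma2 \<phi> x"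
    proof (cases "x = 1")
      case True
      then show ?thesis using s by (simp add: risk_sub_def B0_def V0_def)
    next
      case False
      then have "x < 1" using x by simp
      then have \<phi>: "\<phi> < 1" using x(1) le_less_trans by (fastforce simp: one_ereal_def)
      obtain t where t: "t > 0" "independent_risk t * sub_factor t < sigma2 / (1 - \<phi>)"
        using sub_beats_underparam[OF \<phi> s] by auto
      have "t \<in> admissible" using t admissible_le_1 \<phi> by simp
      then have "independent_risk v * sub_factor v \<le> sigma2 / (1 - \<phi>)"
        using v(2) t(2) by fastforce
      also have "sigma2 / (1 - \<phi>) = sigma2 + sigma2 * \<phi> / (1 - \<phi>)"
        using \<phi> by (simp add: field_simps)
      finally show ?thesis using \<open>x < 1\<close> x(2) by (simp add: risk_sub_def B0_def V0_def)
    qed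
  qed
  with aspect_ratio_in_range[OF v(1)] show ?thesis by auto
qed

lemma risk_spl_under:
  assumes "0 < \<theta>" "\<theta> < 1"
  shows "risk_spl H G rho2 sigma2 \<phi> (ereal \<theta>) = ereal (sigma2 + \<phi> * sigma2 / (1 - \<theta>))"
  using assms by (simp add: risk_spl_def B0_def V0_def C0_def one_ereal_def)

text \<open>
  The weight \<open>\<phi> / \<theta>\<close> cancels the numerator of the variance \<open>\<sigma>\<^sup>2 \<theta> / (1 - \<theta>)\<close>, so on \<open>[\<phi>, 1)\<close> the risk
  increases in \<open>\<theta>\<close> and \<open>\<phi>\<close> is the only underparametrised candidate.  Which of the two candidates wins
  depends on the spectral laws, hence the disjunction.
\<close>
lemma risk_spl_minimizer:
  assumes "0 < rho2" "1 < \<phi> \<or> 0 < sigma2"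
  shows "(\<exists>x\<in>{1<..<\<infinity>}. ereal \<phi> \<le> x \<and> global_min_at (risk_spl H G rho2 sigma2 \<phi>) \<phi> x) \<or>
    \<phi> < 1 \<and> global_min_at (risk_spl H G rho2 sigma2 \<phi>) \<phi> (ereal \<phi>)"
proof -
  let ?f = "risk_spl H G rho2 sigma2 \<phi>"
  let ?R = "\<lambda>v. independent_risk v * spl_factor v"
  have K: "0 \<le> 4 * \<phi> * b ^ 3 / a" using \<phi>_pos H.a_pos H.b_pos by simp
  obtain v where v: "v \<in> admissible" "\<forall>w\<in>admissible. ?R v \<le> ?R w" "?R v < independent_risk 0"
    using attains_min_admissible[OF assms(1) K spl_factor_near_0 continuous_on_spl_factor]
      risk_spl_exceeds_value_at_top assms
    by auto
  have under: "?f (ereal \<phi>) \<le> ?f x" if x: "ereal \<phi> \<le> x" "x \<le> 1" and \<phi>: "\<phi> < 1" for x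
  proof (cases "x = 1")
    case True
    have "sigma2 > 0" using assms \<phi> by auto
    then show ?thesis using True \<phi>_pos by (simp add: risk_spl_def B0_def V0_def C0_def)
  next
    case False
    then obtain \<theta> where \<theta>: "x = ereal \<theta>" "\<phi> \<le> \<theta>" "\<theta> < 1"
      using x by (cases x) (auto simp: one_ereal_def)
    have "\<phi> * sigma2 / (1 - \<phi>) \<le> \<phi> * sigma2 / (1 - \<theta>)"
      using \<theta> \<phi>_pos sigma2_nonneg by (intro divide_left_mono) auto
    then show ?thesis using \<theta> \<phi>_pos by (simp add: risk_spl_under)
  qed
  show ?thesis
  proof (cases "\<phi> < 1 \<and> ?f (ereal \<phi>) \<le> ereal (?R v)")
    case True
    have "global_min_at ?f \<phi> (ereal \<phi>)"
      unfolding is_arg_min_linorder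
    proof (intro conjI allI impI)
      fix x assume x: "x \<in> {ereal \<phi>..\<infinity>}"
      consider "x \<le> 1" | "x = \<infinity>" | w where "w \<in> admissible" "x = aspect_ratio w"
        using aspect_ratio_cases[OF x] by blast
      then show "?f (ereal \<phi>) \<le> ?f x"
      proof cases
        case 1
        then show ?thesis using under x True by simp
      next
        case 2
        have "?f (ereal \<phi>) \<le> ereal (independent_risk 0)"
          using True v(3) by (meson ereal_less_eq(3) less_imp_le order_trans)
        then show ?thesis using 2 risk_infinity(2) by simp
      next
        case 3
        then have "?f (ereal \<phi>) \<le> ereal (?R w)"
          using True v(2) by (meson ereal_less_eq(3) order_trans)
        then show ?thesis using 3 risk_spl_aspect_ratio by simp
      qed
    qed simp
    with True show ?thesis by blast
  next
    case False
    have "global_min_at ?f \<phi> (aspect_ratio v)"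
    proof (rule global_min_at_aspect_ratio[OF risk_infinity(2) risk_spl_aspect_ratio v])
      fix x assume x: "ereal \<phi> \<le> x" "x \<le> 1"
      show "ereal (?R v) \<le> ?f x"
      proof (cases "\<phi> < 1")
        case True
        then show ?thesis using under[OF x] False by auto
      next
        case nless: False
        have "ereal \<phi> \<le> 1" using x by (rule order_trans)
        then have "\<phi> = 1" using nless by (simp add: one_ereal_def)
        then have "x = 1" "0 < sigma2" using x assms by (auto simp: one_ereal_def)
        then show ?thesis using \<phi>_pos by (simp add: risk_spl_def B0_def V0_def C0_def)
      qed
    qed
    with aspect_ratio_in_range[OF v(1)] show ?thesis by auto
  qed
qed

lemma risk_ge_noise:
  assumes "x \<in> {ereal \<phi>..\<infinity>}"
  shows "ereal sigma2 \<le> risk_sub H G rho2 sigma2 \<phi> x" "ereal sigma2 \<le> risk_spl H G rho2 sigma2 \<phi> x"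
proof -
  consider "x = 1" | \<theta> where "x = ereal \<theta>" "\<phi> \<le> \<theta>" "\<theta> < 1" | "x = \<infinity>"
    | w where "w \<in> admissible" "x = aspect_ratio w"
    using aspect_ratio_cases[OF assms] assms by (cases x) (force simp: one_ereal_def)+
  then have "ereal sigma2 \<le> risk_sub H G rho2 sigma2 \<phi> x \<and> ereal sigma2 \<le> risk_spl H G rho2 sigma2 \<phi> x"
  proof cases
    case 1
    then show ?thesis
      using \<phi>_pos by (simp add: risk_sub_def risk_spl_def B0_def V0_def C0_def)
  next
    case 2
    then have "x < 1" by (simp add: one_ereal_def)
    with 2 show ?thesis
      using \<phi>_pos sigma2_nonneg by (simp add: risk_sub_def B0_def V0_def risk_spl_under)
  next
    case 3
    then show ?thesis using independent_risk_ge[of 0] by (simp add: risk_infinity)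
  next
    case 4
    then have w: "0 < w" by (simp add: admissible_def)
    have "sigma2 * 1 \<le> independent_risk w * F" if "1 \<le> F" for F
      using independent_risk_ge[of w] w that sigma2_nonneg by (intro mult_mono) auto
    then show ?thesis
      using 4 risk_sub_aspect_ratio risk_spl_aspect_ratio
        sub_factor_ge_1[OF 4(1)] spl_factor_ge_1[OF w]
      by simp
  qed
  then show "ereal sigma2 \<le> risk_sub H G rho2 sigma2 \<phi> x" "ereal sigma2 \<le> risk_spl H G rho2 sigma2 \<phi> x"
    by auto
qed

lemma global_min_if_noise_floor:
  assumes "x \<in> {ereal \<phi>..\<infinity>}"
  shows "risk_sub H G rho2 sigma2 \<phi> x = ereal sigma2 \<Longrightarrow> global_min_at (risk_sub H G rho2 sigma2 \<phi>) \<phi> x"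
    and "risk_spl H G rho2 sigma2 \<phi> x = ereal sigma2 \<Longrightarrow> global_min_at (risk_spl H G rho2 sigma2 \<phi>) \<phi> x"
  unfolding is_arg_min_linorder using assms risk_ge_noise by auto

lemma noiseless_underparam_risk:
  assumes "sigma2 = 0" "x \<in> {ereal \<phi>..1}"
  shows "risk_sub H G rho2 sigma2 \<phi> x = 0" "risk_spl H G rho2 sigma2 \<phi> x = 0"
  using assms by (auto simp: risk_sub_def risk_spl_def B0_def V0_def C0_def zero_ereal_def[symmetric])

end

theorem proposition4p7:
  fixes H G :: "real measure" and rmin rmax rho2 sigma2 \<phi> :: real
  assumes "0 < rmin" and "rmin \<le> rmax"
    and "real_distribution H" and "AE r in H. r \<in> {rmin..rmax}"
    and "real_distribution G" and "AE r in G. r \<in> {rmin..rmax}"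
    and "rho2 \<ge> 0" and "sigma2 \<ge> 0" and "\<phi> > 0"
  shows
    "let Rsub = risk_sub H G rho2 sigma2 \<phi>;
         Rspl = risk_spl H G rho2 sigma2 \<phi>
     in
     (SNR rho2 sigma2 = 0 \<and> sigma2 \<noteq> 0 \<longrightarrow>
        global_min_at Rsub \<phi> \<infinity> \<and> Rsub \<infinity> = ereal sigma2 \<and>
        global_min_at Rspl \<phi> \<infinity> \<and> Rspl \<infinity> = ereal sigma2)
   \<and> (0 < SNR rho2 sigma2 \<and> SNR rho2 sigma2 < \<infinity> \<longrightarrow>
        (\<exists>\<phi>s \<in> {1<..<\<infinity>}. global_min_at Rsub \<phi> \<phi>s) \<and>
        (\<phi> \<ge> 1 \<longrightarrow> (\<exists>\<phi>s \<in> {1<..<\<infinity>}. global_min_at Rspl \<phi> \<phi>s)) \<and>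
        (\<phi> < 1 \<longrightarrow> (\<exists>\<phi>s \<in> {ereal \<phi>} \<union> {1<..<\<infinity>}. global_min_at Rspl \<phi> \<phi>s)))
   \<and> (SNR rho2 sigma2 = \<infinity> \<longrightarrow>
        (\<phi> \<le> 1 \<longrightarrow>
           (\<forall>\<phi>s \<in> {ereal \<phi>..1}.
              global_min_at Rsub \<phi> \<phi>s \<and> Rsub \<phi>s = 0 \<and>
              global_min_at Rspl \<phi> \<phi>s \<and> Rspl \<phi>s = 0)) \<and>
        (\<phi> > 1 \<longrightarrow>
           (\<exists>\<phi>s \<in> {ereal \<phi>..<\<infinity>}. global_min_at Rsub \<phi> \<phi>s) \<and>
           (\<exists>\<phi>s \<in> {ereal \<phi>..<\<infinity>}. global_min_at Rspl \<phi> \<phi>s)))"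
proof -
  interpret proportional_limit H G rmin rmax rho2 sigma2 \<phi>
    using assms by (intro proportional_limit.intro spectral_law.intro spectral_law_axioms.intro
        proportional_limit_axioms.intro)
  have snr: "SNR rho2 sigma2 = (if sigma2 = 0 then if rho2 = 0 then 0 else \<infinity> else ereal (rho2 / sigma2))"
    using assms by (auto simp: SNR_def)
  let ?Rsub = "risk_sub H G rho2 sigma2 \<phi>" and ?Rspl = "risk_spl H G rho2 sigma2 \<phi>"
  have null: "global_min_at ?Rsub \<phi> \<infinity> \<and> ?Rsub \<infinity> = ereal sigma2 \<and>
      global_min_at ?Rspl \<phi> \<infinity> \<and> ?Rspl \<infinity> = ereal sigma2"
    if "SNR rho2 sigma2 = 0 \<and> sigma2 \<noteq> 0"
  proof -
    have "rho2 = 0" using that by (auto simp: snr split: if_splits)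
    then have "independent_risk 0 = sigma2" unfolding independent_risk_def by simp
    then show ?thesis
      using risk_infinity global_min_if_noise_floor[of \<infinity>] by simp
  qed
  have mid: "0 < rho2 \<and> 0 < sigma2" if "0 < SNR rho2 sigma2 \<and> SNR rho2 sigma2 < \<infinity>"
    using that assms by (auto simp: snr zero_less_divide_iff split: if_splits)
  have inf: "0 < rho2 \<and> sigma2 = 0" if "SNR rho2 sigma2 = \<infinity>"
    using that assms by (auto simp: snr split: if_splits)
  have noiseless: "global_min_at ?Rsub \<phi> x \<and> ?Rsub x = 0 \<and> global_min_at ?Rspl \<phi> x \<and> ?Rspl x = 0"
    if "SNR rho2 sigma2 = \<infinity>" "x \<in> {ereal \<phi>..1}" for x
    using noiseless_underparam_risk[of x] global_min_if_noise_floor[of x] inf that by auto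
  have noisy: "(\<exists>\<phi>s \<in> {1<..<\<infinity>}. global_min_at ?Rsub \<phi> \<phi>s) \<and>
      (\<phi> \<ge> 1 \<longrightarrow> (\<exists>\<phi>s \<in> {1<..<\<infinity>}. global_min_at ?Rspl \<phi> \<phi>s)) \<and>
      (\<phi> < 1 \<longrightarrow> (\<exists>\<phi>s \<in> {ereal \<phi>} \<union> {1<..<\<infinity>}. global_min_at ?Rspl \<phi> \<phi>s))"
    if "0 < SNR rho2 sigma2 \<and> SNR rho2 sigma2 < \<infinity>"
  proof -
    have pos: "0 < rho2" "1 < \<phi> \<or> 0 < sigma2" using mid[OF that] by auto
    show ?thesis using risk_sub_minimizer[OF pos] risk_spl_minimizer[OF pos] by (auto simp: Bex_def)
  qed
  have overparam: "(\<exists>\<phi>s \<in> {ereal \<phi>..<\<infinity>}. global_min_at ?Rsub \<phi> \<phi>s) \<and>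
      (\<exists>\<phi>s \<in> {ereal \<phi>..<\<infinity>}. global_min_at ?Rspl \<phi> \<phi>s)"
    if "SNR rho2 sigma2 = \<infinity>" "\<phi> > 1"
  proof -
    have pos: "0 < rho2" "1 < \<phi> \<or> 0 < sigma2" using inf[OF that(1)] that(2) by auto
    show ?thesis using risk_sub_minimizer[OF pos] risk_spl_minimizer[OF pos] that(2) by (auto simp: Bex_def)
  qed
  show ?thesis
    unfolding Let_def
    using null noisy noiseless overparam by (intro conjI impI ballI) blast+
qed

end
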